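(* Let $G$ and $H$ be graphs such that $\chi_q(G)=\bar{\vartheta}(G)$ and $\chi_q(H)=\bar{\vartheta}(H)$. Then \[\chi_q(G\times H)=\min\{\chi_q(G),\chi_q(H)\}.\]
   Context: Graphs are finite, simple and undirected; no vertex is adjacent to itself. The categorical product $G\times H$ has vertex set $V(G)\times V(H)$, with $(u_1,v_1)\sim(u_2,v_2)$ iff $u_1\sim u_2$ and $v_1\sim v_2$. For a real $k>1$, a strict vector $k$-coloring of $G$ is a map $\varphi$ from $V(G)$ to the unit sphere of some $\mathbb{R}^d$ with $\varphi(u)^T\varphi(v)=-\frac1{k-1}$ whenever $u\sim v$; $\bar{\vartheta}(G)$ is the infimum of such $k$, equivalently the Lovász theta function of the complement of $G$. For a graph $H$ and integer $d\ge1$, the measurement graph $M(H,d)$ has as vertices all tuples $(E_v)_{v\in V(H)}$ of orthogonal projectors in $\mathbb{C}^{d\times d}$ summing to $I$; $(E_v)$ and $(E'_v)$ are adjacent iff $E_vE'_{v'}=0$ whenever $v\not\sim v'$ (including $v=v'$). The quantum chromatic number $\chi_q(G)$ is the least $n$ such that there is a graph homomorphism from $G$ to $M(K_n,d)$ for some $d$. *)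

theory Defs
  imports Complex_Main "Jordan_Normal_Form.Matrix" "Jordan_Normal_Form.Schur_Decomposition"
begin

type_synonym 'a graph = "'a set \<times> ('a \<Rightarrow> 'a \<Rightarrow> bool)"

definition verts :: "'a graph \<Rightarrow> 'a set" where "verts G = fst G"
definition adj :: "'a graph \<Rightarrow> 'a \<Rightarrow> 'a \<Rightarrow> bool" where "adj G = snd G"

definition is_graph :: "'a graph \<Rightarrow> bool" where
  "is_graph G \<longleftrightarrow> finite (verts G)
     \<and> (\<forall>u v. adj G u v \<longrightarrow> u \<in> verts G \<and> v \<in> verts G)
     \<and> (\<forall>u v. adj G u v \<longrightarrow> adj G v u)
     \<and> (\<forall>u. \<not> adj G u u)"

definition cat_prod :: "'a graph \<Rightarrow> 'b graph \<Rightarrow> ('a \<times> 'b) graph" where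
  "cat_prod G H = (verts G \<times> verts H,
     \<lambda>(u1, v1) (u2, v2). adj G u1 u2 \<and> adj H v1 v2)"

definition complete_graph :: "nat \<Rightarrow> nat graph" where
  "complete_graph n = ({0..<n}, \<lambda>i j. i < n \<and> j < n \<and> i \<noteq> j)"

definition is_hom :: "'a graph \<Rightarrow> 'c set \<times> ('c \<Rightarrow> 'c \<Rightarrow> bool) \<Rightarrow> ('a \<Rightarrow> 'c) \<Rightarrow> bool" where
  "is_hom G M f \<longleftrightarrow> (\<forall>u \<in> verts G. f u \<in> fst M)
     \<and> (\<forall>u v. adj G u v \<longrightarrow> snd M (f u) (f v))"

definition orth_proj :: "nat \<Rightarrow> complex mat \<Rightarrow> bool" where
  "orth_proj d P \<longleftrightarrow> P \<in> carrier_mat d d \<and> P * P = P \<and> mat_adjoint P = P"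

definition meas_graph :: "'b graph \<Rightarrow> nat \<Rightarrow> ('b \<Rightarrow> complex mat) set \<times> (('b \<Rightarrow> complex mat) \<Rightarrow> ('b \<Rightarrow> complex mat) \<Rightarrow> bool)" where
  "meas_graph H d =
    ({P. (\<forall>v \<in> verts H. orth_proj d (P v))
         \<and> (\<forall>v. v \<notin> verts H \<longrightarrow> P v = 0\<^sub>m d d)
         \<and> (\<forall>i<d. \<forall>j<d. (\<Sum>v\<in>verts H. P v $$ (i, j)) = (1\<^sub>m d :: complex mat) $$ (i, j))},
     \<lambda>P Q. \<forall>v \<in> verts H. \<forall>w \<in> verts H. \<not> adj H v w \<longrightarrow> P v * Q w = 0\<^sub>m d d)"

definition chi_q :: "'a graph \<Rightarrow> nat" where
  "chi_q G = (LEAST n. \<exists>d \<ge> 1. \<exists>f. is_hom G (meas_graph (complete_graph n) d) f)"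

definition strict_vec_col :: "'a graph \<Rightarrow> real \<Rightarrow> bool" where
  "strict_vec_col G k \<longleftrightarrow> (\<exists>d. \<exists>\<phi> :: 'a \<Rightarrow> real vec.
      (\<forall>u \<in> verts G. \<phi> u \<in> carrier_vec d \<and> \<phi> u \<bullet> \<phi> u = 1)
      \<and> (\<forall>u v. adj G u v \<longrightarrow> \<phi> u \<bullet> \<phi> v = - 1 / (k - 1)))"

definition theta_bar :: "'a graph \<Rightarrow> real" where
  "theta_bar G = Inf {k. k > 1 \<and> strict_vec_col G k}"

end

theory Submission
  imports Defs "HOL-Analysis.Function_Topology"
begin

text \<open>The upper bound is composition with the two projections. For the lower bound, a quantum
  \<open>n\<close>-coloring yields a strict vector \<open>n\<close>-coloring of the product, so it suffices that a graph
  product has a strict vector \<open>n\<close>-coloring only if one of the factors has one. This follows from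
  semidefinite duality: a factor without such a coloring carries a weighted adjacency matrix \<open>A\<close>
  with \<open>- I \<le> A\<close> and largest eigenvalue exceeding \<open>n - 1\<close>, and the tensor product of two such
  matrices, one for each factor, obstructs a strict vector \<open>n\<close>-coloring of the product.\<close>

section \<open>Positive semidefinite matrices over a finite index set\<close>

text \<open>Matrices are functions on an arbitrary index set, so that a product of graphs needs no
  numbering of its vertices.\<close>

definition psd_on :: "'a set \<Rightarrow> ('a \<Rightarrow> 'a \<Rightarrow> real) \<Rightarrow> bool" where
  "psd_on V P \<longleftrightarrow> (\<forall>u\<in>V. \<forall>v\<in>V. P u v = P v u)
     \<and> (\<forall>x. 0 \<le> (\<Sum>u\<in>V. \<Sum>v\<in>V. P u v * x u * x v))"

lemma psd_onI:
  assumes "\<And>u v. u \<in> V \<Longrightarrow> v \<in> V \<Longrightarrow> P u v = P v u"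
    and "\<And>x. 0 \<le> (\<Sum>u\<in>V. \<Sum>v\<in>V. P u v * x u * x v)"
  shows "psd_on V P"
  using assms by (auto simp: psd_on_def)

lemma psd_on_sym: "psd_on V P \<Longrightarrow> u \<in> V \<Longrightarrow> v \<in> V \<Longrightarrow> P u v = P v u"
  by (auto simp: psd_on_def)

lemma psd_on_nonneg: "psd_on V P \<Longrightarrow> 0 \<le> (\<Sum>u\<in>V. \<Sum>v\<in>V. P u v * x u * x v)"
  by (auto simp: psd_on_def)

lemma psd_on_cong:
  assumes "\<And>u v. u \<in> V \<Longrightarrow> v \<in> V \<Longrightarrow> P u v = Q u v"
  shows "psd_on V P \<longleftrightarrow> psd_on V Q"
  unfolding psd_on_def using assms by simp

lemma psd_on_add:
  assumes "psd_on V P" "psd_on V Q"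
  shows "psd_on V (\<lambda>u v. P u v + Q u v)"
proof (rule psd_onI)
  show "0 \<le> (\<Sum>u\<in>V. \<Sum>v\<in>V. (P u v + Q u v) * x u * x v)" for x
    using psd_on_nonneg[OF assms(1), of x] psd_on_nonneg[OF assms(2), of x]
    by (simp add: distrib_right sum.distrib)
qed (use assms in \<open>simp add: psd_on_def\<close>)

lemma psd_on_scale:
  assumes "psd_on V P" "0 \<le> r"
  shows "psd_on V (\<lambda>u v. r * P u v)"
proof (rule psd_onI)
  show "0 \<le> (\<Sum>u\<in>V. \<Sum>v\<in>V. r * P u v * x u * x v)" for x
    using mult_nonneg_nonneg[OF assms(2) psd_on_nonneg[OF assms(1), of x]]
    by (simp add: sum_distrib_left mult.assoc)
qed (use assms in \<open>simp add: psd_on_def\<close>)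

text \<open>The quadratic form is a sum of squares over \<open>I\<close>.\<close>

lemma psd_on_gram:
  "psd_on V (\<lambda>u v. \<Sum>k\<in>I. p k u * p k v)"
proof (rule psd_onI)
  fix x :: "'a \<Rightarrow> real"
  have "(\<Sum>u\<in>V. \<Sum>v\<in>V. (\<Sum>k\<in>I. p k u * p k v) * x u * x v)
      = (\<Sum>u\<in>V. \<Sum>k\<in>I. \<Sum>v\<in>V. (p k u * x u) * (p k v * x v))"
    unfolding sum_distrib_right by (subst sum.swap) (simp add: ac_simps)
  also have "\<dots> = (\<Sum>k\<in>I. (\<Sum>u\<in>V. p k u * x u)\<^sup>2)"
    by (subst sum.swap) (simp add: power2_eq_square sum_product)
  finally show "0 \<le> (\<Sum>u\<in>V. \<Sum>v\<in>V. (\<Sum>k\<in>I. p k u * p k v) * x u * x v)"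
    by (simp add: sum_nonneg)
qed (simp add: mult.commute)

lemma psd_on_identity:
  assumes "finite V"
  shows "psd_on V (\<lambda>u v. if u = v then 1 else 0)"
proof (rule psd_onI)
  fix x :: "'a \<Rightarrow> real"
  have "(\<Sum>u\<in>V. \<Sum>v\<in>V. (if u = v then 1 else 0) * x u * x v)
      = (\<Sum>u\<in>V. \<Sum>v\<in>V. if u = v then (x v)\<^sup>2 else 0)"
    by (intro sum.cong refl) (simp add: power2_eq_square)
  also have "\<dots> = (\<Sum>u\<in>V. (x u)\<^sup>2)"
    using assms by simp
  finally show "0 \<le> (\<Sum>u\<in>V. \<Sum>v\<in>V. (if u = v then 1 else 0) * x u * x v)"
    by (simp add: sum_nonneg)
qed auto

lemma psd_on_2x2:
  assumes "psd_on V P" "finite V" "a \<in> V" "b \<in> V"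
  shows "0 \<le> s\<^sup>2 * P a a + 2 * s * t * P a b + t\<^sup>2 * P b b"
proof -
  \<comment> \<open>Adding the two indicators, rather than choosing between them, covers the case
    \<open>a = b\<close>, which yields the sign of the diagonal below.\<close>
  let ?x = "\<lambda>w. (if w = a then s else 0) + (if w = b then t else 0)"
  have delta: "(\<Sum>v\<in>V. f v * ?x v) = s * f a + t * f b" for f :: "'a \<Rightarrow> real"
    using assms by (simp add: distrib_left sum.distrib if_distrib[of "(*) _"] cong: if_cong)
  have "(\<Sum>u\<in>V. \<Sum>v\<in>V. P u v * ?x u * ?x v) = (\<Sum>u\<in>V. (s * P u a + t * P u b) * ?x u)"
  proof (intro sum.cong refl)
    fix u
    have "(\<Sum>v\<in>V. P u v * ?x u * ?x v) = s * (P u a * ?x u) + t * (P u b * ?x u)"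
      by (rule delta)
    then show "(\<Sum>v\<in>V. P u v * ?x u * ?x v) = (s * P u a + t * P u b) * ?x u"
      by (simp only: distrib_right mult.assoc)
  qed
  also have "\<dots> = s * (s * P a a + t * P a b) + t * (s * P b a + t * P b b)"
    by (rule delta)
  finally have "0 \<le> s * (s * P a a + t * P a b) + t * (s * P b a + t * P b b)"
    using psd_on_nonneg[OF assms(1), of ?x] by simp
  with psd_on_sym[OF assms(1,4,3)] show ?thesis
    by (simp add: algebra_simps power2_eq_square)
qed

lemma psd_on_diag_nonneg:
  assumes "psd_on V P" "finite V" "a \<in> V"
  shows "0 \<le> P a a"
  using psd_on_2x2[OF assms(1-3) assms(3), of 1 0] by simp

lemma psd_on_Cauchy_Schwarz:
  assumes "psd_on V P" "finite V" "a \<in> V" "b \<in> V"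
  shows "(P a b)\<^sup>2 \<le> P a a * P b b"
proof (cases "P a a = 0")
  case True
  have "0 \<le> 2 * s * P a b + P b b" for s
    using psd_on_2x2[OF assms, of s 1] True by simp
  \<comment> \<open>The form is affine in \<open>s\<close> here; if \<open>P a b\<close> is not 0,
    this \<open>s\<close> gives it the value -1.\<close>
  from this[of "- (P b b + 1) / (2 * P a b)"] have "P a b = 0"
    by (cases "P a b = 0") (auto simp: field_simps)
  with True show ?thesis by simp
next
  case False
  then have "0 < P a a" using psd_on_diag_nonneg[OF assms(1-3)] by simp
  \<comment> \<open>At \<open>s = - P a b\<close>, \<open>t = P a a\<close> the form is
    \<open>P a a\<close> times the 2x2 determinant.\<close>
  moreover have "0 \<le> P a a * (P a a * P b b - (P a b)\<^sup>2)"
    using psd_on_2x2[OF assms, of "- P a b" "P a a"] by (simp add: algebra_simps power2_eq_square)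
  ultimately show ?thesis by (simp add: zero_le_mult_iff)
qed

text \<open>Cholesky factorisation: the induction step passes to the Schur complement of one diagonal
  entry. If this entry is 0, so is its row, and division by 0 yields the right values.\<close>

lemma psd_on_imp_gram:
  assumes "finite V" "psd_on V P"
  shows "\<exists>d (p :: nat \<Rightarrow> 'a \<Rightarrow> real). \<forall>u\<in>V. \<forall>v\<in>V. P u v = (\<Sum>k<d. p k u * p k v)"
  using assms
proof (induction V arbitrary: P rule: finite_induct)
  case (insert a V)
  note psd = insert.prems
  have fin: "finite (insert a V)" using insert.hyps by simp
  have sym: "P u v = P v u" if "u \<in> insert a V" "v \<in> insert a V" for u v
    using psd_on_sym[OF psd] that by blast
  have row: "P a u = 0" if "P a a = 0" "u \<in> insert a V" for u
    using psd_on_Cauchy_Schwarz[OF psd fin, of a u] that by simp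
  define Q where "Q u v = P u v - P a u * P a v / P a a" for u v
  have "psd_on V Q"
  proof (rule psd_onI)
    fix x :: "'a \<Rightarrow> real"
    define S where "S = (\<Sum>v\<in>V. P a v * x v)"
    \<comment> \<open>The critical point of the form in the coordinate \<open>a\<close>. The value
      lost there, \<open>S\<^sup>2 / P a a\<close>, is the form of the term subtracted in
      \<open>Q\<close>. If \<open>P a a = 0\<close>, then \<open>t\<close> and this quotient are
      both 0.\<close>
    define t where "t = - S / P a a"
    let ?y = "x(a := t)"
    have y: "(if v = a then t else x v) = x v" if "v \<in> V" for v
      using that insert.hyps by auto
    have S': "(\<Sum>u\<in>V. P u a * x u) = S"
      unfolding S_def using sym by (intro sum.cong) auto
    have "(\<Sum>u\<in>insert a V. \<Sum>v\<in>insert a V. P u v * ?y u * ?y v)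
        = P a a * t * t + (\<Sum>v\<in>V. P a v * t * x v)
          + ((\<Sum>u\<in>V. P u a * x u * t) + (\<Sum>u\<in>V. \<Sum>v\<in>V. P u v * x u * x v))"
      using insert.hyps by (simp add: y sum.distrib cong: sum.cong)
    also have "(\<Sum>u\<in>V. P u a * x u * t) = t * S"
      by (simp add: S'[symmetric] sum_distrib_left mult_ac)
    also have "(\<Sum>v\<in>V. P a v * t * x v) = t * S"
      by (simp add: S_def sum_distrib_left mult_ac)
    also have "P a a * t * t + t * S
          + (t * S + (\<Sum>u\<in>V. \<Sum>v\<in>V. P u v * x u * x v))
        = P a a * t\<^sup>2 + t * S + t * S + (\<Sum>u\<in>V. \<Sum>v\<in>V. P u v * x u * x v)"
      by (simp add: power2_eq_square)
    also have "P a a * t\<^sup>2 + t * S + t * S = - (S\<^sup>2 / P a a)"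
      by (cases "P a a = 0") (auto simp: t_def power2_eq_square field_simps)
    finally have "0 \<le> (\<Sum>u\<in>V. \<Sum>v\<in>V. P u v * x u * x v) - S\<^sup>2 / P a a"
      using psd_on_nonneg[OF psd, of ?y] by simp
    also have "S\<^sup>2 / P a a = (\<Sum>u\<in>V. \<Sum>v\<in>V. P a u * P a v / P a a * x u * x v)"
      unfolding S_def power2_eq_square sum_product sum_divide_distrib
      by (simp add: mult_ac)
    finally show "0 \<le> (\<Sum>u\<in>V. \<Sum>v\<in>V. Q u v * x u * x v)"
      by (simp add: Q_def left_diff_distrib sum_subtractf)
  qed (use sym in \<open>auto simp: Q_def\<close>)
  from insert.IH[OF this] obtain d and p :: "nat \<Rightarrow> 'a \<Rightarrow> real"
    where p: "\<forall>u\<in>V. \<forall>v\<in>V. Q u v = (\<Sum>k<d. p k u * p k v)" by blast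
  \<comment> \<open>The factorisation on \<open>V\<close> is extended by 0 at \<open>a\<close>; the
    new last coordinate supplies the rank-one term removed in \<open>Q\<close>.\<close>
  define q where "q k u = (if k < d then if u = a then 0 else p k u else P a u / sqrt (P a a))"
    for k u
  have a0: "0 \<le> P a a" using psd_on_diag_nonneg[OF psd fin] by simp
  have q: "(\<Sum>k<Suc d. q k u * q k v)
      = (if u = a \<or> v = a then 0 else \<Sum>k<d. p k u * p k v) + P a u * P a v / P a a" for u v
    using a0 by (simp add: q_def)
  have "P u v = (\<Sum>k<Suc d. q k u * q k v)" if "u \<in> insert a V" "v \<in> insert a V" for u v
  proof (cases "u = a \<or> v = a")
    case True
    then show ?thesis
      unfolding q using row[OF _ that(1)] row[OF _ that(2)] sym[OF that]
      by (cases "P a a = 0") auto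
  next
    case False
    then show ?thesis
      unfolding q using p that by (auto simp: Q_def diff_eq_eq)
  qed
  then show ?case by blast
qed auto

text \<open>Gram vectors composed with \<open>f\<close> are Gram vectors again. This includes
  non-injective \<open>f\<close> such as the projections of a product.\<close>

lemma psd_on_pullback:
  assumes "finite V" "psd_on V P" "f ` S \<subseteq> V"
  shows "psd_on S (\<lambda>s t. P (f s) (f t))"
proof -
  obtain d and p :: "nat \<Rightarrow> 'a \<Rightarrow> real"
    where p: "\<forall>u\<in>V. \<forall>v\<in>V. P u v = (\<Sum>k<d. p k u * p k v)"
    using psd_on_imp_gram[OF assms(1,2)] by blast
  have "psd_on S (\<lambda>s t. \<Sum>k<d. p k (f s) * p k (f t))"
    using psd_on_gram[of S "\<lambda>k s. p k (f s)" "{..<d}"] .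
  moreover have "P (f s) (f t) = (\<Sum>k<d. p k (f s) * p k (f t))" if "s \<in> S" "t \<in> S" for s t
    using p assms(3) that by (simp add: image_subset_iff)
  ultimately show ?thesis
    by (simp add: psd_on_cong[where P = "\<lambda>s t. P (f s) (f t)"])
qed

text \<open>Schur product theorem: a Gram factorisation of \<open>Q\<close> turns the form at
  \<open>x\<close> into a sum of forms of \<open>P\<close>, taken at the vectors
  \<open>p k u * x u\<close>.\<close>

lemma psd_on_hadamard:
  assumes "finite V" "psd_on V P" "psd_on V Q"
  shows "psd_on V (\<lambda>u v. P u v * Q u v)"
proof (rule psd_onI)
  fix x :: "'a \<Rightarrow> real"
  obtain d and p :: "nat \<Rightarrow> 'a \<Rightarrow> real"
    where p: "\<forall>u\<in>V. \<forall>v\<in>V. Q u v = (\<Sum>k<d. p k u * p k v)"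
    using psd_on_imp_gram[OF assms(1,3)] by blast
  have "(\<Sum>u\<in>V. \<Sum>v\<in>V. P u v * Q u v * x u * x v)
      = (\<Sum>u\<in>V. \<Sum>v\<in>V. \<Sum>k<d. P u v * (p k u * x u) * (p k v * x v))"
    by (intro sum.cong refl) (simp add: p sum_distrib_left mult_ac)
  also have "\<dots> = (\<Sum>u\<in>V. \<Sum>k<d. \<Sum>v\<in>V. P u v * (p k u * x u) * (p k v * x v))"
    by (intro sum.cong refl sum.swap)
  also have "\<dots> = (\<Sum>k<d. \<Sum>u\<in>V. \<Sum>v\<in>V. P u v * (p k u * x u) * (p k v * x v))"
    by (rule sum.swap)
  also have "0 \<le> \<dots>"
    by (intro sum_nonneg psd_on_nonneg[OF assms(2)])
  finally show "0 \<le> (\<Sum>u\<in>V. \<Sum>v\<in>V. P u v * Q u v * x u * x v)" .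
qed (use assms in \<open>simp add: psd_on_def\<close>)

text \<open>A tensor product is the entrywise product of the pullbacks along the two
  projections.\<close>

lemma psd_on_tensor:
  assumes "finite V" "finite U" "psd_on V P" "psd_on U Q"
  shows "psd_on (V \<times> U) (\<lambda>s t. P (fst s) (fst t) * Q (snd s) (snd t))"
proof (rule psd_on_hadamard)
  show "psd_on (V \<times> U) (\<lambda>s t. P (fst s) (fst t))"
    using assms by (intro psd_on_pullback[where f = fst]) auto
  show "psd_on (V \<times> U) (\<lambda>s t. Q (snd s) (snd t))"
    using assms by (intro psd_on_pullback[where f = snd]) auto
qed (use assms in simp)

section \<open>Semidefinite duality by compactness\<close>

text \<open>Tychonoff's theorem, transferred to the topology of the function type.\<close>

lemma compact_PiE_UNIV:
  fixes S :: "'i \<Rightarrow> 'b::topological_space set"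
  assumes "\<And>i. compact (S i)"
  shows "compact (PiE UNIV S)"
proof -
  have "compactin (product_topology (\<lambda>_. euclidean) UNIV) (PiE UNIV S)"
    using assms by (simp add: compactin_PiE)
  then show ?thesis by (simp add: euclidean_product_topology)
qed

lemma continuous_on_coordinate:
  fixes A :: "('i \<Rightarrow> 'b::topological_space) set"
  shows "continuous_on A (\<lambda>x. x i)"
  by (rule continuous_on_subset[OF continuous_on_product_coordinates]) simp

text \<open>First-order condition at a minimum: after division by \<open>e\<close>, the linear term
  decides as \<open>e\<close> tends to 0.\<close>

lemma linear_coefficient_nonneg:
  fixes a b :: real
  assumes "\<And>e. 0 < e \<Longrightarrow> e \<le> 1 \<Longrightarrow> 0 \<le> 2 * e * a + e\<^sup>2 * b"
  shows "0 \<le> a"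
proof (rule ccontr)
  assume "\<not> 0 \<le> a"
  \<comment> \<open>Small enough that \<open>e * b <= - a\<close>, hence
    \<open>2 * a + e * b <= a < 0\<close>.\<close>
  define e where "e = min 1 (- a / (\<bar>b\<bar> + 1))"
  have e: "0 < e" "e \<le> 1" using \<open>\<not> 0 \<le> a\<close> by (auto simp: e_def divide_neg_pos)
  have "e * b \<le> e * (\<bar>b\<bar> + 1)" using e by (intro mult_left_mono) auto
  also have "\<dots> \<le> - a / (\<bar>b\<bar> + 1) * (\<bar>b\<bar> + 1)" by (intro mult_right_mono) (auto simp: e_def)
  also have "\<dots> = - a" by simp
  finally have "2 * a + e * b < 0" using \<open>\<not> 0 \<le> a\<close> by simp
  then have "e * (2 * a + e * b) < 0" using e by (simp add: mult_pos_neg)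
  with assms[OF e] show False by (simp add: algebra_simps power2_eq_square)
qed

text \<open>Each symmetry equation and each instance of nonnegativity is a closed condition on
  finitely many coordinates. Uncurrying makes the matrices a single product space.\<close>

lemma closed_psd_on:
  assumes "finite V"
  shows "closed {X :: 'a \<times> 'a \<Rightarrow> real. psd_on V (\<lambda>u v. X (u, v))}"
proof -
  have "{X :: 'a \<times> 'a \<Rightarrow> real. psd_on V (\<lambda>u v. X (u, v))}
      = (\<Inter>u\<in>V. \<Inter>v\<in>V. {X. X (u, v) = X (v, u)})
        \<inter> (\<Inter>x. {X. 0 \<le> (\<Sum>u\<in>V. \<Sum>v\<in>V. X (u, v) * x u * x v)})"
    by (auto simp: psd_on_def)
  also have "closed \<dots>"
    by (intro closed_Int closed_INT ballI closed_Collect_eq closed_Collect_le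
        continuous_intros continuous_on_coordinate)
  finally show ?thesis .
qed

text \<open>Farkas' lemma for completing a partial matrix \<open>T\<close> with specified diagonal to a positive
  semidefinite one. The certificate \<open>R\<close> is the residual of a best approximation of \<open>T\<close> on the
  specified entries, which exists by compactness.\<close>

lemma psd_completion_Farkas:
  assumes fin: "finite V"
    and M_sym: "\<And>u v. M u v \<Longrightarrow> M v u" and M_refl: "\<And>u. u \<in> V \<Longrightarrow> M u u"
    and T_sym: "\<And>u v. T u v = T v u"
    and none: "\<And>X. psd_on V X \<Longrightarrow> \<exists>u\<in>V. \<exists>v\<in>V. M u v \<and> X u v \<noteq> T u v"
  shows "\<exists>R. psd_on V R \<and> (\<forall>u v. \<not> M u v \<longrightarrow> R u v = 0)
    \<and> (\<Sum>u\<in>V. \<Sum>v\<in>V. R u v * T u v) < 0"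
proof -
  define F where "F X = (\<Sum>u\<in>V. \<Sum>v\<in>V. if M u v then (X u v - T u v)\<^sup>2 else 0)" for X
  \<comment> \<open>If a positive semidefinite matrix approximates \<open>T\<close> at least as well
    as 0 does, its entries on \<open>V\<close> are bounded by \<open>r\<close>: on the diagonal by
    closeness to \<open>T\<close>, elsewhere by Cauchy-Schwarz. Minimising over \<open>S\<close>
    therefore suffices.\<close>
  define r where "r = (\<Sum>u\<in>V. \<bar>T u u\<bar>) + sqrt (F (\<lambda>_ _. 0))"
  \<comment> \<open>Entries outside \<open>V\<close> are fixed at 0, since nothing else bounds
    them.\<close>
  define S where "S = PiE UNIV (\<lambda>(u, v). if u \<in> V \<and> v \<in> V then {- r..r} else {0})
    \<inter> {X. psd_on V (\<lambda>u v. X (u, v))}"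
  have F_entry: "(X u v - T u v)\<^sup>2 \<le> F X" if "u \<in> V" "v \<in> V" "M u v" for X u v
  proof -
    have "(X u v - T u v)\<^sup>2 = (if M u v then (X u v - T u v)\<^sup>2 else 0)" using that by simp
    also have "\<dots> \<le> (\<Sum>v\<in>V. if M u v then (X u v - T u v)\<^sup>2 else 0)"
      using fin that by (intro member_le_sum) auto
    also have "\<dots> \<le> F X"
      unfolding F_def using fin that
      by (intro member_le_sum[where f = "\<lambda>u. \<Sum>v\<in>V. if M u v then (X u v - T u v)\<^sup>2 else 0"])
        (auto intro: sum_nonneg)
    finally show ?thesis .
  qed
  have F_nonneg: "0 \<le> F X" for X unfolding F_def by (intro sum_nonneg) auto
  have r_nonneg: "0 \<le> r" unfolding r_def using F_nonneg by (intro add_nonneg_nonneg sum_nonneg) auto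
  have "compact S"
    unfolding S_def using fin
    by (intro compact_Int_closed compact_PiE_UNIV closed_psd_on) auto
  moreover have zero: "(\<lambda>_. 0) \<in> S"
    using r_nonneg by (auto simp: S_def psd_on_def)
  moreover have "continuous_on S (\<lambda>X. F (\<lambda>u v. X (u, v)))"
    unfolding F_def
  proof (intro continuous_on_sum)
    show "continuous_on S (\<lambda>X. if M u v then (X (u, v) - T u v)\<^sup>2 else 0)" for u v
      by (cases "M u v") (auto intro!: continuous_intros continuous_on_coordinate)
  qed
  ultimately obtain X0 where X0: "X0 \<in> S"
    and X0_min: "\<And>X. X \<in> S \<Longrightarrow> F (\<lambda>u v. X0 (u, v)) \<le> F (\<lambda>u v. X (u, v))"
    using continuous_attains_inf[of S] by blast
  define X where "X = (\<lambda>u v. X0 (u, v))"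
  have X_psd: "psd_on V X" using X0 by (simp add: S_def X_def)
  have X_min: "F X \<le> F Y" if "psd_on V Y" for Y
  proof (cases "F Y \<le> F (\<lambda>_ _. 0)")
    case True
    have diag: "Y u u \<le> r" if "u \<in> V" for u
    proof -
      have "Y u u - T u u \<le> sqrt (F (\<lambda>_ _. 0))"
        using F_entry[OF that that M_refl[OF that], of Y] True by (intro real_le_rsqrt) simp
      moreover have "\<bar>T u u\<bar> \<le> (\<Sum>u\<in>V. \<bar>T u u\<bar>)"
        using fin that by (intro member_le_sum) auto
      ultimately show ?thesis unfolding r_def by linarith
    qed
    have "\<bar>Y u v\<bar> \<le> r" if "u \<in> V" "v \<in> V" for u v
    proof (rule abs_le_square_iff[THEN iffD2, of _ r, simplified abs_of_nonneg[OF r_nonneg]])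
      have "(Y u v)\<^sup>2 \<le> Y u u * Y v v"
        using psd_on_Cauchy_Schwarz[OF \<open>psd_on V Y\<close> fin] that by simp
      also have "\<dots> \<le> r * r"
        using diag that psd_on_diag_nonneg[OF \<open>psd_on V Y\<close> fin] r_nonneg by (intro mult_mono) auto
      finally show "(Y u v)\<^sup>2 \<le> r\<^sup>2" by (simp add: power2_eq_square)
    qed
    then have "(\<lambda>(u, v). if u \<in> V \<and> v \<in> V then Y u v else 0) \<in> S"
      using \<open>psd_on V Y\<close> by (auto simp: S_def abs_le_iff psd_on_def minus_le_iff)
    from X0_min[OF this] have "F X \<le> F (\<lambda>u v. if u \<in> V \<and> v \<in> V then Y u v else 0)"
      by (simp add: X_def)
    also have "\<dots> = F Y" unfolding F_def by (intro sum.cong refl) simp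
    finally show ?thesis .
  next
    case False
    with X0_min[OF zero] show ?thesis by (simp add: X_def)
  qed
  \<comment> \<open>\<open>R\<close> is half the gradient of \<open>F\<close> at the minimiser
    \<open>X\<close>, and \<open>IP Y\<close> is half the derivative in the direction
    \<open>Y\<close>.\<close>
  define R where "R u v = (if M u v then X u v - T u v else 0)" for u v
  define IP where "IP Y = (\<Sum>u\<in>V. \<Sum>v\<in>V. R u v * Y u v)" for Y
  define N where "N Y = (\<Sum>u\<in>V. \<Sum>v\<in>V. if M u v then (Y u v)\<^sup>2 else 0)"
    for Y :: "'a \<Rightarrow> 'a \<Rightarrow> real"
  have expand: "F (\<lambda>u v. X u v + e * Y u v) = F X + 2 * e * IP Y + e\<^sup>2 * N Y" for e Y
    unfolding F_def IP_def N_def R_def sum_distrib_left sum.distrib[symmetric]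
    by (intro sum.cong refl) (simp add: power2_eq_square algebra_simps)
  have IP_nonneg: "0 \<le> IP Y" if "psd_on V Y" for Y
  proof (rule linear_coefficient_nonneg)
    fix e :: real assume "0 < e"
    then show "0 \<le> 2 * e * IP Y + e\<^sup>2 * N Y"
      using X_min[OF psd_on_add[OF X_psd psd_on_scale[OF that, of e]]] by (simp add: expand)
  qed
  \<comment> \<open>The segment from \<open>X\<close> to 0 stays positive semidefinite, so the
    derivative in the direction \<open>- X\<close> is nonnegative too.\<close>
  have "0 \<le> - IP X"
  proof (rule linear_coefficient_nonneg)
    fix e :: real assume "e \<le> 1"
    then have "psd_on V (\<lambda>u v. (1 - e) * X u v)" by (intro psd_on_scale X_psd) simp
    also have "(\<lambda>u v. (1 - e) * X u v) = (\<lambda>u v. X u v + (- e) * X u v)"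
      by (simp add: algebra_simps)
    finally show "0 \<le> 2 * e * (- IP X) + e\<^sup>2 * N X"
      using X_min[of "\<lambda>u v. X u v + (- e) * X u v"] expand[of "- e" X] by simp
  qed
  moreover have "0 < IP X - IP T"
  proof -
    obtain u v where uv: "u \<in> V" "v \<in> V" "M u v" "X u v \<noteq> T u v" using none[OF X_psd] by blast
    then have "0 < (X u v - T u v)\<^sup>2" by simp
    also have "\<dots> \<le> F X" using F_entry uv by blast
    also have "F X = IP X - IP T"
      unfolding F_def IP_def R_def sum_subtractf[symmetric]
      by (intro sum.cong refl) (simp add: power2_eq_square algebra_simps)
    finally show ?thesis .
  qed
  ultimately have "IP T < 0" by linarith
  moreover have "psd_on V R"
  proof (rule psd_onI)
    show "R u v = R v u" if "u \<in> V" "v \<in> V" for u v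
      using psd_on_sym[OF X_psd that] T_sym[of u v] M_sym by (auto simp: R_def)
    fix x :: "'a \<Rightarrow> real"
    \<comment> \<open>Rank-one matrices as directions show that \<open>R\<close> itself is positive
      semidefinite.\<close>
    have "psd_on V (\<lambda>u v. x u * x v)" using psd_on_gram[of V "\<lambda>_. x" "{()}"] by simp
    from IP_nonneg[OF this] show "0 \<le> (\<Sum>u\<in>V. \<Sum>v\<in>V. R u v * x u * x v)"
      by (simp add: IP_def mult.assoc)
  qed
  ultimately show ?thesis by (intro exI[of _ R]) (simp add: IP_def R_def)
qed

text \<open>Rescaling the certificate by its diagonal turns it into a weighted adjacency matrix \<open>A\<close> with
  least eigenvalue at least \<open>- 1\<close> and largest eigenvalue \<open>l > 1 / c\<close>.\<close>

lemma weighted_adjacency_certificate: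
  fixes V :: "'a set"
  assumes fin: "finite V" and E_sym: "\<And>u v. E u v \<Longrightarrow> E v u" and E_irrefl: "\<And>u. \<not> E u u"
    and c: "0 < c"
    and none: "\<not> (\<exists>X. psd_on V X \<and> (\<forall>u\<in>V. X u u = 1) \<and> (\<forall>u\<in>V. \<forall>v\<in>V. E u v \<longrightarrow> X u v = - c))"
  shows "\<exists>A x l. (\<forall>u v. \<not> E u v \<longrightarrow> A u v = 0) \<and> 1 < l * c
    \<and> psd_on V (\<lambda>u v. (if u = v then 1 else 0) + A u v)
    \<and> psd_on V (\<lambda>u v. (if u = v then l else 0) - A u v)
    \<and> (\<Sum>u\<in>V. (x u)\<^sup>2) = 1 \<and> (\<Sum>u\<in>V. \<Sum>v\<in>V. A u v * x u * x v) = l"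
proof -
  \<comment> \<open>Only the diagonal and the edges are prescribed; the value on other pairs never
    enters.\<close>
  define T where "T u v = (if u = v then 1 else - c)" for u v :: 'a
  have "\<exists>R. psd_on V R \<and> (\<forall>u v. \<not> (u = v \<or> E u v) \<longrightarrow> R u v = 0)
    \<and> (\<Sum>u\<in>V. \<Sum>v\<in>V. R u v * T u v) < 0"
  proof (rule psd_completion_Farkas[OF fin])
    fix X assume "psd_on V X"
    with none show "\<exists>u\<in>V. \<exists>v\<in>V. (u = v \<or> E u v) \<and> X u v \<noteq> T u v"
      using E_irrefl unfolding T_def by metis
  qed (use E_sym in \<open>auto simp: T_def\<close>)
  then obtain R where R_psd: "psd_on V R" and R_supp: "\<And>u v. u \<noteq> v \<Longrightarrow> \<not> E u v \<Longrightarrow> R u v = 0"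
    and R_neg: "(\<Sum>u\<in>V. \<Sum>v\<in>V. R u v * T u v) < 0" by blast
  define W where "W u v = (if E u v then R u v else 0)" for u v
  have R_split: "R u v = (if u = v then R u u else 0) + W u v" for u v
    using R_supp E_irrefl by (auto simp: W_def)
  have diag_sum: "(\<Sum>v\<in>V. (if u = v then f v else 0)) = f u" if "u \<in> V" for u and f :: "'a \<Rightarrow> real"
    using fin that by simp
  \<comment> \<open>The gap of the certificate: minus the pairing of \<open>R\<close> with
    \<open>T\<close>.\<close>
  define q where "q = c * (\<Sum>u\<in>V. \<Sum>v\<in>V. W u v) - (\<Sum>u\<in>V. R u u)"
  have "(\<Sum>u\<in>V. \<Sum>v\<in>V. R u v * T u v)
      = (\<Sum>u\<in>V. \<Sum>v\<in>V. (if u = v then R v v else 0) - c * W u v)"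
    using E_irrefl by (intro sum.cong refl) (auto simp: T_def W_def R_supp)
  also have "\<dots> = - q"
    by (simp add: sum_subtractf diag_sum q_def sum_distrib_left)
  finally have q: "0 < q" using R_neg by simp
  then have "V \<noteq> {}" by (auto simp: q_def)
  \<comment> \<open>Diagonal entries of \<open>R\<close> can be 0, so each is raised by
    \<open>e\<close> before the rescaling. The raises add up to \<open>q / 2\<close>, which leaves
    half of the gap: \<open>c * Q y = N y + q / 2\<close>.\<close>
  define e where "e = q / (2 * card V)"
  have e: "0 < e" using q fin \<open>V \<noteq> {}\<close> by (simp add: e_def card_gt_0_iff)
  define y where "y u = sqrt (R u u + e)" for u
  have y_pos: "0 < y u" if "u \<in> V" for u
    using psd_on_diag_nonneg[OF R_psd fin that] e by (simp add: y_def)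
  have y_sq: "(y u)\<^sup>2 = R u u + e" if "u \<in> V" for u
    using psd_on_diag_nonneg[OF R_psd fin that] e by (simp add: y_def)
  define A where "A u v = W u v / (y u * y v)" for u v
  have A_sym: "A u v = A v u" if "u \<in> V" "v \<in> V" for u v
    using psd_on_sym[OF R_psd that] E_sym by (auto simp: A_def W_def mult.commute)
  define Q where "Q x = (\<Sum>u\<in>V. \<Sum>v\<in>V. A u v * x u * x v)" for x
  define N where "N x = (\<Sum>u\<in>V. (x u)\<^sup>2)" for x :: "'a \<Rightarrow> real"
  have diag_form: "(\<Sum>u\<in>V. \<Sum>v\<in>V. (if u = v then r else 0) * x u * x v) = r * N x"
    for r and x :: "'a \<Rightarrow> real"
  proof -
    have "(\<Sum>u\<in>V. \<Sum>v\<in>V. (if u = v then r else 0) * x u * x v)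
        = (\<Sum>u\<in>V. \<Sum>v\<in>V. if u = v then r * (x v)\<^sup>2 else 0)"
      by (intro sum.cong refl) (simp add: power2_eq_square)
    then show ?thesis by (simp add: diag_sum N_def sum_distrib_left)
  qed
  \<comment> \<open>The substitution \<open>x u = y u * z u\<close> turns the form of
    \<open>I + A\<close> into the form of \<open>R + e * I\<close>.\<close>
  have lower: "0 \<le> N x + Q x" for x
  proof -
    define z where "z u = x u / y u" for u
    have xz: "x u = y u * z u" if "u \<in> V" for u using y_pos[OF that] by (simp add: z_def)
    have "N x = (\<Sum>u\<in>V. R u u * (z u)\<^sup>2) + e * (\<Sum>u\<in>V. (z u)\<^sup>2)"
      unfolding N_def sum_distrib_left sum.distrib[symmetric]
      by (intro sum.cong refl) (simp add: xz power_mult_distrib y_sq distrib_right)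
    moreover have "Q x = (\<Sum>u\<in>V. \<Sum>v\<in>V. W u v * z u * z v)"
      unfolding Q_def A_def z_def by (simp add: mult_ac)
    moreover have "(\<Sum>u\<in>V. \<Sum>v\<in>V. R u v * z u * z v)
        = (\<Sum>u\<in>V. \<Sum>v\<in>V. (if u = v then R v v * (z v)\<^sup>2 else 0) + W u v * z u * z v)"
      by (intro sum.cong refl, subst R_split) (simp add: distrib_right power2_eq_square)
    ultimately have "N x + Q x = (\<Sum>u\<in>V. \<Sum>v\<in>V. R u v * z u * z v) + e * (\<Sum>u\<in>V. (z u)\<^sup>2)"
      by (simp add: sum.distrib diag_sum)
    then show ?thesis
      using psd_on_nonneg[OF R_psd, of z] e by (simp add: sum_nonneg)
  qed
  \<comment> \<open>The unit sphere of vectors supported on \<open>V\<close>, written as a closed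
    subset of a compact box.\<close>
  define S where "S = PiE UNIV (\<lambda>u. if u \<in> V then {- 1..1} else {0::real}) \<inter> {x. N x = 1}"
  have "closed {x. N x = 1}"
    unfolding N_def by (intro closed_Collect_eq continuous_intros continuous_on_coordinate)
  then have "compact S"
    unfolding S_def by (intro compact_Int_closed compact_PiE_UNIV) auto
  have normalise: "\<exists>x\<in>S. Q x = Q z / N z" if "0 < N z" for z
  proof -
    define x where "x u = (if u \<in> V then z u / sqrt (N z) else 0)" for u
    have "N x = (\<Sum>u\<in>V. (z u)\<^sup>2 / N z)"
      unfolding N_def[of x] using that
      by (intro sum.cong refl) (simp add: x_def power_divide)
    then have "N x = 1" using that by (simp add: sum_divide_distrib[symmetric] N_def[symmetric])
    moreover have "\<bar>x u\<bar> \<le> 1" if "u \<in> V" for u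
    proof -
      have "(x u)\<^sup>2 \<le> N x" unfolding N_def using fin that by (intro member_le_sum) auto
      with \<open>N x = 1\<close> show ?thesis using abs_le_square_iff[of "x u" 1] by simp
    qed
    moreover have "x u = 0" if "u \<notin> V" for u using that by (simp add: x_def)
    ultimately have "x \<in> S" by (auto simp: S_def abs_le_iff minus_le_iff)
    moreover have "Q x = Q z / N z"
      unfolding Q_def sum_divide_distrib using that
      by (intro sum.cong refl) (simp add: x_def)
    ultimately show ?thesis by blast
  qed
  have N_y: "N y = (\<Sum>u\<in>V. R u u) + q / 2"
  proof -
    have "N y = (\<Sum>u\<in>V. R u u + e)" unfolding N_def by (intro sum.cong refl y_sq)
    then show ?thesis using fin \<open>V \<noteq> {}\<close> by (simp add: sum.distrib e_def)
  qed
  have Q_y: "Q y = (\<Sum>u\<in>V. \<Sum>v\<in>V. W u v)"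
    unfolding Q_def A_def
  proof (intro sum.cong refl)
    fix u v assume "u \<in> V" "v \<in> V"
    then show "W u v / (y u * y v) * y u * y v = W u v" using y_pos[of u] y_pos[of v] by simp
  qed
  have N_y_pos: "0 < N y"
    unfolding N_def using fin \<open>V \<noteq> {}\<close> y_pos by (intro sum_pos zero_less_power) auto
  \<comment> \<open>The Rayleigh quotient of \<open>A\<close> at \<open>y\<close> exceeds
    \<open>1 / c\<close>. Its maximum over the sphere is at least as large and serves as
    \<open>l\<close>.\<close>
  obtain x1 where x1: "x1 \<in> S" "Q x1 = Q y / N y" using normalise[OF N_y_pos] by blast
  have "continuous_on S Q"
    unfolding Q_def by (intro continuous_intros continuous_on_coordinate)
  then obtain x where x: "x \<in> S" and x_max: "\<And>z. z \<in> S \<Longrightarrow> Q z \<le> Q x"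
    using continuous_attains_sup[OF \<open>compact S\<close>] x1(1) by blast
  have "1 < Q y / N y * c"
    using N_y_pos q by (simp add: N_y Q_y q_def field_simps)
  also have "\<dots> \<le> Q x * c"
    using x_max[OF x1(1)] x1(2) c by (intro mult_right_mono) auto
  finally have "1 < Q x * c" .
  have upper: "Q z \<le> Q x * N z" for z
  proof (cases "0 < N z")
    case True
    then obtain x' where "x' \<in> S" "Q x' = Q z / N z" using normalise by blast
    with x_max True show ?thesis by (fastforce simp: divide_le_eq)
  next
    case False
    moreover have "0 \<le> N z" unfolding N_def by (intro sum_nonneg) auto
    ultimately have "N z = 0" by simp
    then have "z u = 0" if "u \<in> V" for u
      using fin that unfolding N_def by (simp add: sum_nonneg_eq_0_iff)
    then have "Q z = 0" unfolding Q_def by simp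
    with \<open>N z = 0\<close> show ?thesis by simp
  qed
  have "psd_on V (\<lambda>u v. (if u = v then 1 else 0) + A u v)"
  proof (rule psd_onI)
    show "0 \<le> (\<Sum>u\<in>V. \<Sum>v\<in>V. ((if u = v then 1 else 0) + A u v) * x u * x v)" for x
      using lower[of x] diag_form[of 1 x] by (simp add: distrib_right sum.distrib Q_def)
  qed (use A_sym in auto)
  moreover have "psd_on V (\<lambda>u v. (if u = v then Q x else 0) - A u v)"
  proof (rule psd_onI)
    show "0 \<le> (\<Sum>u\<in>V. \<Sum>v\<in>V. ((if u = v then Q x else 0) - A u v) * z u * z v)" for z
      using upper[of z] diag_form[of "Q x" z] by (simp add: left_diff_distrib sum_subtractf Q_def)
  qed (use A_sym in auto)
  moreover have "\<forall>u v. \<not> E u v \<longrightarrow> A u v = 0" by (simp add: A_def W_def)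
  moreover have "N x = 1" using x by (simp add: S_def)
  ultimately show ?thesis
    using \<open>1 < Q x * c\<close> unfolding N_def Q_def by blast
qed

section \<open>Vector colorings of a categorical product\<close>

text \<open>The spectrum of \<open>A \<otimes> B\<close> is bounded below by \<open>- max l m\<close> and its top eigenvalue is \<open>l * m\<close>.
  With \<open>n = max l m\<close>, the lower bound follows from the identity
  \<open>(n - a) * (n - b) + n * ((1 + a) * (1 + b)) = (1 + n) * (n + a * b)\<close>.\<close>

lemma categorical_product_certificate:
  fixes V :: "'a set" and U :: "'b set"
  assumes fin: "finite V" "finite U"
    and E: "\<And>u v. E u v \<Longrightarrow> E v u" "\<And>u. \<not> E u u"
    and F: "\<And>u v. F u v \<Longrightarrow> F v u" "\<And>u. \<not> F u u"
    and c: "0 < c"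
    and K_psd: "psd_on (V \<times> U) K" and K_diag: "\<And>s. s \<in> V \<times> U \<Longrightarrow> K s s = 1"
    and K_edge: "\<And>s t. s \<in> V \<times> U \<Longrightarrow> t \<in> V \<times> U \<Longrightarrow> E (fst s) (fst t)
      \<Longrightarrow> F (snd s) (snd t) \<Longrightarrow> K s t = - c"
  shows "(\<exists>X. psd_on V X \<and> (\<forall>u\<in>V. X u u = 1) \<and> (\<forall>u\<in>V. \<forall>v\<in>V. E u v \<longrightarrow> X u v = - c))
    \<or> (\<exists>X. psd_on U X \<and> (\<forall>u\<in>U. X u u = 1) \<and> (\<forall>u\<in>U. \<forall>v\<in>U. F u v \<longrightarrow> X u v = - c))"
proof (rule ccontr)
  assume "\<not> ?thesis"
  then have none: "\<not> (\<exists>X. psd_on V X \<and> (\<forall>u\<in>V. X u u = 1) \<and> (\<forall>u\<in>V. \<forall>v\<in>V. E u v \<longrightarrow> X u v = - c))"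
    "\<not> (\<exists>X. psd_on U X \<and> (\<forall>u\<in>U. X u u = 1) \<and> (\<forall>u\<in>U. \<forall>v\<in>U. F u v \<longrightarrow> X u v = - c))"
    by blast+
  obtain A x l where A: "\<forall>u v. \<not> E u v \<longrightarrow> A u v = 0" "1 < l * c"
    "psd_on V (\<lambda>u v. (if u = v then 1 else 0) + A u v)"
    "psd_on V (\<lambda>u v. (if u = v then l else 0) - A u v)"
    "(\<Sum>u\<in>V. (x u)\<^sup>2) = 1" "(\<Sum>u\<in>V. \<Sum>v\<in>V. A u v * x u * x v) = l"
    using weighted_adjacency_certificate[OF fin(1) E c none(1)] by blast
  obtain B y m where B: "\<forall>u v. \<not> F u v \<longrightarrow> B u v = 0" "1 < m * c"
    "psd_on U (\<lambda>u v. (if u = v then 1 else 0) + B u v)"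
    "psd_on U (\<lambda>u v. (if u = v then m else 0) - B u v)"
    "(\<Sum>u\<in>U. (y u)\<^sup>2) = 1" "(\<Sum>u\<in>U. \<Sum>v\<in>U. B u v * y u * y v) = m"
    using weighted_adjacency_certificate[OF fin(2) F c none(2)] by blast
  define n where "n = max l m"
  have pos: "0 < l" "0 < m" using A(2) B(2) c by (smt (verit) mult_nonpos_nonneg)+
  have n: "0 < n" using pos by (simp add: n_def)
  have raise: "psd_on W (\<lambda>u v. (if u = v then n else 0) - C u v)"
    if "psd_on W (\<lambda>u v. (if u = v then r else 0) - C u v)" "finite W" "r \<le> n"
    for W :: "'w set" and C r
  proof -
    have "psd_on W (\<lambda>u v. (n - r) * (if u = v then 1 else 0) + ((if u = v then r else 0) - C u v))"
      using that by (intro psd_on_add psd_on_scale psd_on_identity) auto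
    then show ?thesis
      by (rule psd_on_cong[THEN iffD1, rotated]) auto
  qed
  define P where "P s t = (if s = t then n else 0) + A (fst s) (fst t) * B (snd s) (snd t)" for s t
  have "psd_on (V \<times> U) (\<lambda>s t. (1 + n) * P s t)"
  proof -
    have "psd_on (V \<times> U) (\<lambda>s t.
        ((if fst s = fst t then n else 0) - A (fst s) (fst t))
          * ((if snd s = snd t then n else 0) - B (snd s) (snd t))
        + n * (((if fst s = fst t then 1 else 0) + A (fst s) (fst t))
          * ((if snd s = snd t then 1 else 0) + B (snd s) (snd t))))"
      using n by (intro psd_on_add psd_on_scale
          psd_on_tensor[OF fin raise[OF A(4) fin(1)] raise[OF B(4) fin(2)]]
          psd_on_tensor[OF fin A(3) B(3)]) (auto simp: n_def)
    then show ?thesis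
      by (rule psd_on_cong[THEN iffD1, rotated])
        (auto simp: P_def prod_eq_iff algebra_simps)
  qed
  then have "psd_on (V \<times> U) (\<lambda>s t. (1 + n) * P s t * K s t)"
    by (rule psd_on_hadamard[rotated, OF _ K_psd]) (use fin in simp)
  \<comment> \<open>The tensor product of the unit vectors attaining \<open>l\<close> and
    \<open>m\<close>: a unit vector at which the form of the tensor product of \<open>A\<close> and
    \<open>B\<close> is \<open>l * m\<close>.\<close>
  define z where "z s = x (fst s) * y (snd s)" for s
  have "0 \<le> (\<Sum>s\<in>V\<times>U. \<Sum>t\<in>V\<times>U. (1 + n) * P s t * K s t * z s * z t)"
    by (rule psd_on_nonneg) fact
  also have "\<dots> = (\<Sum>s\<in>V\<times>U. \<Sum>t\<in>V\<times>U. (1 + n) *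
      ((if s = t then n * (z t)\<^sup>2 else 0) - c * (A (fst s) (fst t) * B (snd s) (snd t) * z s * z t)))"
  proof (intro sum.cong refl)
    fix s t assume st: "s \<in> V \<times> U" "t \<in> V \<times> U"
    \<comment> \<open>The product of the two entries vanishes off the edges of the product graph,
      and on these edges \<open>K\<close> is \<open>- c\<close>.\<close>
    have "A (fst s) (fst t) * B (snd s) (snd t) * K s t = A (fst s) (fst t) * B (snd s) (snd t) * (- c)"
      using K_edge[OF st] A(1) B(1) by (cases "E (fst s) (fst t) \<and> F (snd s) (snd t)") auto
    then have "P s t * K s t = (if s = t then n else 0) - c * (A (fst s) (fst t) * B (snd s) (snd t))"
      using K_diag[OF st(1)] by (auto simp: P_def distrib_right)
    then show "(1 + n) * P s t * K s t * z s * z t = (1 + n) *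
      ((if s = t then n * (z t)\<^sup>2 else 0) - c * (A (fst s) (fst t) * B (snd s) (snd t) * z s * z t))"
      by (simp add: mult.assoc power2_eq_square left_diff_distrib)
  qed
  also have "\<dots> = (1 + n) * (n * (\<Sum>s\<in>V\<times>U. (z s)\<^sup>2)
      - c * (\<Sum>s\<in>V\<times>U. \<Sum>t\<in>V\<times>U. A (fst s) (fst t) * B (snd s) (snd t) * z s * z t))"
    using fin by (simp add: sum_distrib_left[symmetric] sum_subtractf)
  also have "(\<Sum>s\<in>V\<times>U. (z s)\<^sup>2) = (\<Sum>u\<in>V. (x u)\<^sup>2) * (\<Sum>u\<in>U. (y u)\<^sup>2)"
    by (simp add: z_def power_mult_distrib sum_product sum.cartesian_product case_prod_unfold)
  also have "(\<Sum>s\<in>V\<times>U. \<Sum>t\<in>V\<times>U. A (fst s) (fst t) * B (snd s) (snd t) * z s * z t)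
      = (\<Sum>u\<in>V. \<Sum>u'\<in>U. \<Sum>v\<in>V. \<Sum>v'\<in>U. (A u v * x u * x v) * (B u' v' * y u' * y v'))"
    by (simp add: sum.cartesian_product' z_def mult_ac)
  also have "\<dots> = (\<Sum>u\<in>V. \<Sum>v\<in>V. A u v * x u * x v) * (\<Sum>u\<in>U. \<Sum>v\<in>U. B u v * y u * y v)"
    by (simp add: sum_product)
  finally have "0 \<le> (1 + n) * (n - c * (l * m))"
    by (simp add: A B)
  then have "c * (l * m) \<le> n" using n by (simp add: zero_le_mult_iff)
  \<comment> \<open>Multiplying \<open>1 < l * c\<close> by \<open>m\<close> and
    \<open>1 < m * c\<close> by \<open>l\<close> bounds both candidates for the maximum.\<close>
  moreover have "n < c * (l * m)"
    using mult_strict_left_mono[OF A(2) pos(2)] mult_strict_left_mono[OF B(2) pos(1)]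
    by (simp add: n_def max_def mult_ac)
  ultimately show False by simp
qed

section \<open>Strict vector colorings and the theta function\<close>

lemma theta_bar_le:
  assumes "1 < k" "strict_vec_col G k"
  shows "theta_bar G \<le> k"
  unfolding theta_bar_def
  by (rule cInf_lower) (use assms in \<open>auto intro!: bdd_belowI[of _ 1]\<close>)

text \<open>A Gram factorisation of \<open>X\<close> supplies the vectors of the coloring.\<close>

lemma strict_vec_col_if_psd:
  assumes "is_graph G" "psd_on (verts G) X" "\<And>u. u \<in> verts G \<Longrightarrow> X u u = 1"
    and edge: "\<And>u v. adj G u v \<Longrightarrow> X u v = - 1 / (k - 1)"
  shows "strict_vec_col G k"
proof -
  have adj: "u \<in> verts G \<and> v \<in> verts G" if "adj G u v" for u v
    using assms(1) that by (auto simp: is_graph_def)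
  obtain d and p :: "nat \<Rightarrow> 'a \<Rightarrow> real"
    where p: "\<forall>u\<in>verts G. \<forall>v\<in>verts G. X u v = (\<Sum>k<d. p k u * p k v)"
    using psd_on_imp_gram[OF _ assms(2)] assms(1) unfolding is_graph_def by blast
  define \<phi> where "\<phi> u = vec d (\<lambda>k. p k u)" for u
  have inner: "\<phi> u \<bullet> \<phi> v = X u v" if "u \<in> verts G" "v \<in> verts G" for u v
    using p that by (simp add: \<phi>_def scalar_prod_def lessThan_atLeast0)
  show ?thesis
    unfolding strict_vec_col_def
    by (intro exI[of _ d] exI[of _ \<phi>]) (use inner adj assms(3) edge in \<open>auto simp: \<phi>_def\<close>)
qed

text \<open>A constant unit vector colors an edgeless graph. The bound lies below 2, so it leaves
  only 0 and 1 when theta equals a natural number.\<close>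

lemma theta_bar_edgeless:
  assumes "\<And>u v. \<not> adj G u v"
  shows "theta_bar G \<le> 3 / 2"
proof (rule theta_bar_le)
  show "strict_vec_col G (3 / 2)"
    unfolding strict_vec_col_def using assms
    by (intro exI[of _ 1] exI[of _ "\<lambda>_. vec 1 (\<lambda>_. 1)"]) (simp add: scalar_prod_def)
qed simp

section \<open>Orthogonal projectors and quantum colorings\<close>

lemma mat_adjoint_index:
  assumes "A \<in> carrier_mat d d" "i < d" "j < d"
  shows "mat_adjoint A $$ (i, j) = conjugate (A $$ (j, i))"
  using assms unfolding mat_adjoint_def by (simp add: mat_of_rows_index)

lemma orth_proj_hermitian:
  assumes "orth_proj d P" "i < d" "j < d"
  shows "cnj (P $$ (i, j)) = P $$ (j, i)"
  using mat_adjoint_index[of P d j i] assms by (simp add: orth_proj_def)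

lemma orth_proj_one: "orth_proj d (1\<^sub>m d)"
  and orth_proj_zero: "orth_proj d (0\<^sub>m d d)"
proof -
  have "mat_adjoint A = A" if "A \<in> carrier_mat d d" "\<And>i j. i < d \<Longrightarrow> j < d \<Longrightarrow> cnj (A $$ (j, i)) = A $$ (i, j)"
    for A :: "complex mat"
  proof (rule eq_matI)
    show "dim_row (mat_adjoint A) = dim_row A" "dim_col (mat_adjoint A) = dim_col A"
      using that(1) by (auto simp: mat_adjoint_def)
    show "mat_adjoint A $$ (i, j) = A $$ (i, j)" if "i < dim_row A" "j < dim_col A" for i j
      using mat_adjoint_index[of A d i j] \<open>A \<in> carrier_mat d d\<close> that
        \<open>\<And>i j. i < d \<Longrightarrow> j < d \<Longrightarrow> cnj (A $$ (j, i)) = A $$ (i, j)\<close> by auto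
  qed
  then show "orth_proj d (1\<^sub>m d)" "orth_proj d (0\<^sub>m d d)"
    by (auto simp: orth_proj_def)
qed

text \<open>The entrywise inner product is the trace of \<open>P\<close> times the adjoint of
  \<open>Q\<close>, and \<open>Q\<close> is Hermitian.\<close>

lemma orth_proj_trace_inner:
  assumes "orth_proj d P" "orth_proj d Q"
  shows "(\<Sum>a<d. \<Sum>b<d. P $$ (a, b) * cnj (Q $$ (a, b))) = (\<Sum>a<d. (P * Q) $$ (a, a))"
proof (intro sum.cong refl)
  fix a assume "a \<in> {..<d}"
  then show "(\<Sum>b<d. P $$ (a, b) * cnj (Q $$ (a, b))) = (P * Q) $$ (a, a)"
    using assms by (auto simp: orth_proj_def scalar_prod_def lessThan_atLeast0
        orth_proj_hermitian[OF assms(2)] intro!: sum.cong)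
qed

text \<open>The vector of a vertex consists of the entries of its projectors, centred by subtracting
  \<open>I / n\<close> from each of them.\<close>

lemma quantum_coloring_psd:
  assumes hom: "is_hom G (meas_graph (complete_graph n) d) f" and d: "1 \<le> d" and n: "2 \<le> n"
    and graph: "is_graph G"
  shows "\<exists>K. psd_on (verts G) K \<and> (\<forall>s\<in>verts G. K s s = 1)
    \<and> (\<forall>s t. adj G s t \<longrightarrow> K s t = - 1 / (real n - 1))"
proof -
  have proj: "orth_proj d (f s i)" if "s \<in> verts G" "i < n" for s i
    using hom that by (auto simp: is_hom_def meas_graph_def complete_graph_def verts_def)
  have unit: "(\<Sum>i<n. f s i $$ (a, a)) = 1" if "s \<in> verts G" "a < d" for s a
    using hom that
    by (auto simp: is_hom_def meas_graph_def complete_graph_def verts_def lessThan_atLeast0)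
  have orth: "f s i * f t i = 0\<^sub>m d d" if "adj G s t" "i < n" for s t i
    using hom that
    by (auto simp: is_hom_def meas_graph_def complete_graph_def verts_def adj_def)
  have adj: "s \<in> verts G \<and> t \<in> verts G" if "adj G s t" for s t
    using graph that by (auto simp: is_graph_def)
  define c :: "'a \<Rightarrow> nat \<times> nat \<times> nat \<Rightarrow> complex" where
    "c s = (\<lambda>(i, a, b). f s i $$ (a, b) - (if a = b then 1 / of_nat n else 0))" for s
  define I where "I = {..<n} \<times> {..<d} \<times> {..<d}"
  \<comment> \<open>The real part of a complex Gram matrix is the sum of the Gram matrices of the
    real and the imaginary parts.\<close>
  define K0 where "K0 s t = Re (\<Sum>k\<in>I. c s k * cnj (c t k))" for s t
  have "psd_on (verts G) (\<lambda>s t. (\<Sum>k\<in>I. Re (c s k) * Re (c t k)) + (\<Sum>k\<in>I. Im (c s k) * Im (c t k)))"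
    by (intro psd_on_add psd_on_gram)
  also have "(\<lambda>s t. (\<Sum>k\<in>I. Re (c s k) * Re (c t k)) + (\<Sum>k\<in>I. Im (c s k) * Im (c t k))) = K0"
    by (simp add: K0_def fun_eq_iff sum.distrib)
  finally have K0_psd: "psd_on (verts G) K0" .
  have trace: "(\<Sum>i<n. \<Sum>a<d. f s i $$ (a, a)) = of_nat d" if "s \<in> verts G" for s
    by (subst sum.swap) (use unit[OF that] in simp)
  \<comment> \<open>Since the traces of the projectors add up to \<open>d\<close>, each cross term
    of the centring contributes \<open>- d / n\<close>; the constant term gives \<open>d / n\<close>
    back.\<close>
  have K0: "K0 s t = Re (\<Sum>i<n. \<Sum>a<d. (f s i * f t i) $$ (a, a)) - d / n"
    if "s \<in> verts G" "t \<in> verts G" for s t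
  proof -
    have "(\<Sum>k\<in>I. c s k * cnj (c t k))
        = (\<Sum>i<n. \<Sum>a<d. \<Sum>b<d. f s i $$ (a, b) * cnj (f t i $$ (a, b))
            - (if a = b then 1 / of_nat n * f s i $$ (b, b) else 0)
            - (if a = b then 1 / of_nat n * cnj (f t i $$ (b, b)) else 0)
            + (if a = b then 1 / (of_nat n)\<^sup>2 else 0))"
      unfolding I_def sum.cartesian_product'
      by (intro sum.cong refl) (simp add: c_def algebra_simps power2_eq_square)
    also have "\<dots> = (\<Sum>i<n. \<Sum>a<d. \<Sum>b<d. f s i $$ (a, b) * cnj (f t i $$ (a, b)))
        - 1 / of_nat n * (\<Sum>i<n. \<Sum>a<d. f s i $$ (a, a))
        - 1 / of_nat n * cnj (\<Sum>i<n. \<Sum>a<d. f t i $$ (a, a))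
        + of_nat n * of_nat d / (of_nat n)\<^sup>2"
      by (simp add: sum.distrib sum_subtractf sum_distrib_left sum_divide_distrib)
    also have "(\<Sum>i<n. \<Sum>a<d. \<Sum>b<d. f s i $$ (a, b) * cnj (f t i $$ (a, b)))
        = (\<Sum>i<n. \<Sum>a<d. (f s i * f t i) $$ (a, a))"
      using proj that by (intro sum.cong refl orth_proj_trace_inner) auto
    finally have "(\<Sum>k\<in>I. c s k * cnj (c t k))
        = (\<Sum>i<n. \<Sum>a<d. (f s i * f t i) $$ (a, a)) - of_real (d / n)"
      using n by (simp add: trace[OF that(1)] trace[OF that(2)] power2_eq_square)
    then show ?thesis by (simp add: K0_def)
  qed
  \<comment> \<open>Normalises the diagonal value \<open>d - d / n\<close> to 1; the edge value
    \<open>- d / n\<close> then becomes \<open>- 1 / (n - 1)\<close>.\<close>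
  define r where "r = n / (d * (real n - 1))"
  have diag: "r * K0 s s = 1" if "s \<in> verts G" for s
  proof -
    have "(\<Sum>i<n. \<Sum>a<d. (f s i * f s i) $$ (a, a)) = of_nat d"
      using proj[OF that] trace[OF that] by (simp add: orth_proj_def)
    then have "K0 s s = d - d / n" using K0[OF that that] by simp
    then show ?thesis using d n by (simp add: r_def field_simps)
  qed
  have edge: "r * K0 s t = - 1 / (real n - 1)" if "adj G s t" for s t
  proof -
    have "K0 s t = - (d / n)"
      using K0 adj[OF that] by (simp add: orth[OF that])
    then show ?thesis using d n by (simp add: r_def)
  qed
  have "psd_on (verts G) (\<lambda>s t. r * K0 s t)"
    using n by (intro psd_on_scale K0_psd) (simp add: r_def)
  with diag edge show ?thesis by blast
qed

text \<open>Handles \<open>n < 2\<close>, outside the range of the vector construction. An empty sum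
  of projectors cannot be the identity of size \<open>d >= 1\<close>, and a single projector must be
  the identity, which is not orthogonal to itself.\<close>

lemma quantum_coloring_few_colors:
  assumes hom: "is_hom G (meas_graph (complete_graph n) d) f" and d: "1 \<le> d"
    and graph: "is_graph G"
  shows "n = 0 \<Longrightarrow> verts G = {}" and "n \<le> 1 \<Longrightarrow> \<not> adj G u v"
proof -
  show empty: "verts G = {}" if "n = 0"
    using hom d that by (fastforce simp: is_hom_def meas_graph_def complete_graph_def verts_def)
  show "\<not> adj G u v" if "n \<le> 1"
  proof
    assume uv: "adj G u v"
    then have V: "u \<in> verts G" "v \<in> verts G" using graph by (auto simp: is_graph_def)
    with empty that have n: "n = 1" by (cases n) auto
    have one: "f w 0 = 1\<^sub>m d" if "w \<in> verts G" for w
      using hom that n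
      by (intro eq_matI) (auto simp: is_hom_def meas_graph_def complete_graph_def verts_def orth_proj_def)
    have "f u 0 * f v 0 = 0\<^sub>m d d"
      using hom uv n by (auto simp: is_hom_def meas_graph_def complete_graph_def verts_def adj_def)
    then have "(1\<^sub>m d :: complex mat) $$ (0, 0) = 0\<^sub>m d d $$ (0, 0)" using one V by simp
    then show False using d by simp
  qed
qed

text \<open>Giving each vertex its own color, encoded by projectors of size 1, shows that the
  minimum defining \<open>chi_q\<close> is attained.\<close>

lemma quantum_coloring_exists:
  assumes "is_graph G"
  shows "\<exists>n. \<exists>d\<ge>1. \<exists>f. is_hom G (meas_graph (complete_graph n) d) f"
proof -
  obtain h where h: "bij_betw h (verts G) {0..<card (verts G)}"
    using ex_bij_betw_finite_nat assms unfolding is_graph_def by blast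
  define f :: "'a \<Rightarrow> nat \<Rightarrow> complex mat" where
    "f u i = (if i = h u then 1\<^sub>m 1 else 0\<^sub>m 1 1)" for u i
  have less: "h u < card (verts G)" if "u \<in> verts G" for u
    using bij_betwE[OF h] that by auto
  have inj: "h u \<noteq> h v" if "adj G u v" for u v
    using bij_betw_imp_inj_on[OF h] assms that unfolding is_graph_def inj_on_def by metis
  have "is_hom G (meas_graph (complete_graph (card (verts G))) 1) f"
    unfolding is_hom_def
  proof (intro conjI ballI allI impI)
    fix u assume "u \<in> verts G"
    then show "f u \<in> fst (meas_graph (complete_graph (card (verts G))) 1)"
      using less[of u] orth_proj_one[of 1] orth_proj_zero[of 1]
      by (auto simp: meas_graph_def complete_graph_def verts_def f_def if_distrib[of "\<lambda>A. A $$ _"]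
          cong: if_cong)
  next
    fix u v assume "adj G u v"
    then show "snd (meas_graph (complete_graph (card (verts G))) 1) (f u) (f v)"
      using inj[of u v]
      by (auto simp: meas_graph_def complete_graph_def verts_def adj_def f_def)
  qed
  then show ?thesis by (intro exI[of _ "card (verts G)"] exI[of _ 1]) blast
qed

section \<open>The quantum chromatic number of a product\<close>

lemma chi_q_attained:
  assumes "is_graph G"
  shows "\<exists>d\<ge>1. \<exists>f. is_hom G (meas_graph (complete_graph (chi_q G)) d) f"
  unfolding chi_q_def by (rule LeastI_ex) (rule quantum_coloring_exists[OF assms])

lemma chi_q_le:
  assumes "is_hom G (meas_graph (complete_graph n) d) f" "1 \<le> d"
  shows "chi_q G \<le> n"
  unfolding chi_q_def by (rule Least_le) (use assms in blast)

lemma chi_q_empty: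
  assumes "is_graph G" "verts G = {}"
  shows "chi_q G = 0"
  using chi_q_le[of G 0 1] assms by (simp add: is_graph_def is_hom_def)

lemma is_graph_cat_prod:
  assumes "is_graph G" "is_graph H"
  shows "is_graph (cat_prod G H)"
  using assms by (auto simp: is_graph_def cat_prod_def verts_def adj_def)

lemma verts_cat_prod: "verts (cat_prod G H) = verts G \<times> verts H"
  by (simp add: cat_prod_def verts_def)

lemma adj_cat_prod: "adj (cat_prod G H) s t \<longleftrightarrow> adj G (fst s) (fst t) \<and> adj H (snd s) (snd t)"
  by (auto simp: cat_prod_def adj_def split: prod.splits)

lemma chi_q_cat_prod_le:
  assumes "is_graph G" "is_graph H"
  shows "chi_q (cat_prod G H) \<le> min (chi_q G) (chi_q H)"
proof -
  obtain d f where "1 \<le> d" and f: "is_hom G (meas_graph (complete_graph (chi_q G)) d) f"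
    using chi_q_attained[OF assms(1)] by blast
  have "is_hom (cat_prod G H) (meas_graph (complete_graph (chi_q G)) d) (\<lambda>s. f (fst s))"
    using f by (auto simp: is_hom_def verts_cat_prod adj_cat_prod)
  moreover obtain e g where "1 \<le> e" and g: "is_hom H (meas_graph (complete_graph (chi_q H)) e) g"
    using chi_q_attained[OF assms(2)] by blast
  have "is_hom (cat_prod G H) (meas_graph (complete_graph (chi_q H)) e) (\<lambda>s. g (snd s))"
    using g by (auto simp: is_hom_def verts_cat_prod adj_cat_prod)
  ultimately show ?thesis
    using chi_q_le \<open>1 \<le> d\<close> \<open>1 \<le> e\<close> by (metis min.bounded_iff)
qed

lemma theta_bar_le_if_psd:
  assumes "is_graph G" "2 \<le> n"
    and "\<exists>X. psd_on (verts G) X \<and> (\<forall>u\<in>verts G. X u u = 1)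
      \<and> (\<forall>u\<in>verts G. \<forall>v\<in>verts G. adj G u v \<longrightarrow> X u v = - (1 / (real n - 1)))"
  shows "theta_bar G \<le> n"
proof -
  obtain X where X: "psd_on (verts G) X" "\<forall>u\<in>verts G. X u u = 1"
    "\<forall>u\<in>verts G. \<forall>v\<in>verts G. adj G u v \<longrightarrow> X u v = - (1 / (real n - 1))"
    using assms(3) by blast
  have "strict_vec_col G n"
    using assms(1) X by (intro strict_vec_col_if_psd[OF _ X(1)]) (auto simp: is_graph_def)
  then show ?thesis using assms(2) by (intro theta_bar_le) auto
qed

theorem theorem7p3:
  fixes G :: "'a graph" and H :: "'b graph"
  assumes "is_graph G" and "is_graph H"
    and "real (chi_q G) = theta_bar G"
    and "real (chi_q H) = theta_bar H"
  shows "chi_q (cat_prod G H) = min (chi_q G) (chi_q H)"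
proof (rule antisym[OF chi_q_cat_prod_le[OF assms(1,2)]], rule ccontr)
  define n where "n = chi_q (cat_prod G H)"
  assume "\<not> min (chi_q G) (chi_q H) \<le> chi_q (cat_prod G H)"
  then have less: "n < chi_q G" "n < chi_q H" by (auto simp: n_def)
  note graph = is_graph_cat_prod[OF assms(1,2)]
  obtain d f where d: "1 \<le> d"
    and hom: "is_hom (cat_prod G H) (meas_graph (complete_graph n) d) f"
    using chi_q_attained[OF graph] unfolding n_def by blast
  show False
  proof (cases "2 \<le> n")
    case True
    obtain K where K: "psd_on (verts G \<times> verts H) K" "\<forall>s\<in>verts G \<times> verts H. K s s = 1"
      "\<forall>s t. adj G (fst s) (fst t) \<and> adj H (snd s) (snd t) \<longrightarrow> K s t = - 1 / (real n - 1)"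
      using quantum_coloring_psd[OF hom d True graph] unfolding verts_cat_prod adj_cat_prod by blast
    \<comment> \<open>Either alternative contradicts \<open>n < chi_q\<close>, as theta and
      \<open>chi_q\<close> agree on both factors.\<close>
    have "theta_bar G \<le> n \<or> theta_bar H \<le> n"
      using theta_bar_le_if_psd[OF assms(1) True] theta_bar_le_if_psd[OF assms(2) True]
        categorical_product_certificate[of "verts G" "verts H" "adj G" "adj H" "1 / (real n - 1)" K]
        K assms(1,2) True
      unfolding is_graph_def by auto
    with less assms(3,4) show False by linarith
  next
    case False
    \<comment> \<open>The product has no edge, so one of the factors has none.\<close>
    then have "\<not> (adj G u u' \<and> adj H v v')" for u u' v v'
      using quantum_coloring_few_colors(2)[OF hom d graph, of "(u, v)" "(u', v')"]
      by (simp add: adj_cat_prod)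
    then have "theta_bar G \<le> 3 / 2 \<or> theta_bar H \<le> 3 / 2"
      using theta_bar_edgeless[of G] theta_bar_edgeless[of H] by meson
    \<comment> \<open>The edgeless factor has \<open>chi_q\<close> at most 1, and \<open>n\<close>
      is strictly smaller. With no colors the product is empty, so some factor is empty and has
      \<open>chi_q\<close> equal to 0.\<close>
    with less assms(3,4) have "n = 0" by linarith
    then have "verts G = {} \<or> verts H = {}"
      using quantum_coloring_few_colors(1)[OF hom d graph] by (auto simp: verts_cat_prod)
    then have "chi_q G = 0 \<or> chi_q H = 0"
      by (elim disj_forward) (fact chi_q_empty[OF assms(1)] chi_q_empty[OF assms(2)])+
    with less show False by simp
  qed
qed

end
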